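(* Let $q$ and $t$ be odd primes. (i) If $q=4t+1$, then for any integer $n\ge 2$ the factorization of $\Phi_{2^nt}(x)$ over $\mathbb{F}_q$ is given by $$\Phi_{2^nt}(x)=\prod_{1\le j\le t-1}\bigl(x^{2^{n-2}}\pm\sqrt{-1}\cdot 16^j\bigr).$$ (ii) If $q=2t+1$ and $3\le k\le u$, then for any integer $n\ge k$ the factorization of $\Phi_{2^nt}(x)$ over $\mathbb{F}_q$ is given by $$\Phi_{2^nt}(x)=\prod_{\substack{1\le i\le 2^{k-3}\\ 1\le j\le t-1}}\bigl(x^{2^{n-k+1}}\pm 4^j\,\mathbb{T}(\beta_{2^k}^{2i-1})\,x^{2^{n-k}}+\chi(\beta_{2^k})16^j\bigr).$$
   Context: $\mathbb{F}_q$ is the finite field with $q$ elements; integers are read as elements of $\mathbb{F}_q$. $\Phi_m(x)$ denotes the $m$th cyclotomic polynomial, viewed over $\mathbb{F}_q$. A factor written with $\pm$ in a product stands for the product of the two factors obtained from the two sign choices. In (i), $\sqrt{-1}$ denotes a fixed square root of $-1$ in $\mathbb{F}_q$. In (ii), where $q\equiv 3\pmod 4$: put $Q=q^2=2^uv+1$ with $v$ odd (so $u\ge 3$); $\beta_{2^k}$ is a primitive $2^k$th root of unity in $\mathbb{F}_Q^*$ for $0\le k\le u$; $\mathbb{T}:\mathbb{F}_Q\to\mathbb{F}_q$ is the trace $\mathbb{T}(x)=x+x^q$; and $\chi(\beta_{2^k})=\beta_{2^k}^{q+1}$, which equals $1$ if $0\le k<u$ and $-1$ if $k=u$. *)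

theory Defs
  imports Complex_Main "HOL-Library.Cardinality"
    "HOL-Computational_Algebra.Computational_Algebra"
begin

definition cyclotomic_complex :: "nat \<Rightarrow> complex poly" where
  "cyclotomic_complex m =
     (\<Prod>k\<in>{k \<in> {1..m}. coprime k m}. [:- cis (2 * pi * real k / real m), 1:])"

text \<open>The coefficients are integers (\<open>of_int_poly_cyclotomic_int\<close> below), so the description in
  \<open>cyclotomic_int\<close> is well defined and the polynomial can be read over any commutative ring.\<close>

definition cyclotomic_int :: "nat \<Rightarrow> int poly" where
  "cyclotomic_int m = (THE p. map_poly of_int p = cyclotomic_complex m)"

definition cyclotomic :: "nat \<Rightarrow> 'a::comm_ring_1 poly" where
  "cyclotomic m = map_poly of_int (cyclotomic_int m)"

definition primitive_root_of_unity :: "nat \<Rightarrow> 'a::field \<Rightarrow> bool" where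
  "primitive_root_of_unity m x \<longleftrightarrow> m > 0 \<and> x ^ m = 1 \<and> (\<forall>l. 0 < l \<and> l < m \<longrightarrow> x ^ l \<noteq> 1)"

definition field_embedding :: "('a::field \<Rightarrow> 'b::field) \<Rightarrow> bool" where
  "field_embedding h \<longleftrightarrow>
     h 1 = 1 \<and> (\<forall>x y. h (x + y) = h x + h y) \<and> (\<forall>x y. h (x * y) = h x * h y)"

text \<open>Let \<open>h\<close> embed the field with \<open>q\<close> elements into the field with \<open>q\<^sup>2\<close> elements, \<open>q\<close> prime.
  The elements \<open>x + x ^ q\<close> and \<open>x ^ (q + 1)\<close> of the big field lie in the image of \<open>h\<close>; the
  functions below return them as elements of the small field (see \<open>embed_quad_trace\<close> and
  \<open>embed_quad_chi\<close>).\<close>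

definition quad_trace :: "('a::finite_field \<Rightarrow> 'b::field) \<Rightarrow> 'b \<Rightarrow> 'a" where
  "quad_trace h x = (THE y. h y = x + x ^ CARD('a))"

definition quad_chi :: "('a::finite_field \<Rightarrow> 'b::field) \<Rightarrow> 'b \<Rightarrow> 'a" where
  "quad_chi h x = (THE y. h y = x ^ (CARD('a) + 1))"


subsection \<open>The cyclotomic polynomial has integer coefficients\<close>

lemma map_poly_of_int_mult:
  "map_poly of_int (p * q) = (map_poly of_int p * map_poly of_int q :: 'a::comm_ring_1 poly)"
  by (rule poly_eqI) (simp add: coeff_map_poly coeff_mult)

lemma map_poly_of_int_add:
  "map_poly of_int (p + q) = (map_poly of_int p + map_poly of_int q :: 'a::comm_ring_1 poly)"
  by (rule poly_eqI) (simp add: coeff_map_poly)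

lemma map_poly_of_int_prod:
  "map_poly of_int (\<Prod>i\<in>A. f i) = (\<Prod>i\<in>A. map_poly of_int (f i) :: 'a::comm_ring_1 poly)"
  by (induction A rule: infinite_finite_induct) (simp_all add: map_poly_of_int_mult)

lemma map_poly_of_int_complex_inj:
  assumes "map_poly of_int p = (map_poly of_int q :: complex poly)"
  shows "p = q"
proof (rule poly_eqI)
  fix n
  have "coeff (map_poly of_int p :: complex poly) n = coeff (map_poly of_int q) n"
    using assms by simp
  then show "coeff p n = coeff q n" by (simp add: coeff_map_poly)
qed

lemma lead_coeff_cyclotomic_complex: "lead_coeff (cyclotomic_complex m) = 1"
  unfolding cyclotomic_complex_def by (simp add: lead_coeff_prod)

lemma prod_roots_of_unity:
  assumes "m > 0"
  shows "(\<Prod>k\<in>{1..m}. [:- cis (2 * pi * real k / real m), 1:]) = monom 1 m - 1"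
    (is "?L = ?R")
proof -
  let ?z = "\<lambda>k. cis (2 * pi * real k / real m)"
  have "?L = (\<Prod>k\<in>{..<m}. [:- ?z k, 1:])"
  proof (rule prod.reindex_bij_witness[where i = "\<lambda>k. if k = 0 then m else k"
        and j = "\<lambda>k. if k = m then 0 else k"])
    fix k assume "k \<in> {1..m}"
    show "[:- ?z (if k = m then 0 else k), 1:] = [:- ?z k, 1:]"
      using assms by auto
  qed (use assms in \<open>auto split: if_splits\<close>)
  also have "\<dots> = ?R"
  proof (rule poly_eqI_degree_lead_coeff[where n = m and A = "{z. z ^ m = 1}"])
    show "coeff (\<Prod>k\<in>{..<m}. [:- ?z k, 1:]) m = coeff ?R m"
    proof -
      have d: "degree (\<Prod>k\<in>{..<m}. [:- ?z k, 1:]) = m"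
        by (subst degree_prod_eq_sum_degree) auto
      have "lead_coeff (\<Prod>k\<in>{..<m}. [:- ?z k, 1:]) = 1"
        by (simp add: lead_coeff_prod)
      then show ?thesis using d assms by simp
    qed
    show "m \<le> card {z::complex. z ^ m = 1}" using card_roots_unity_eq[OF assms] by simp
    show "degree (\<Prod>k\<in>{..<m}. [:- ?z k, 1:]) \<le> m"
      by (subst degree_prod_eq_sum_degree) auto
    show "degree ?R \<le> m" by (intro degree_diff_le) (auto simp: degree_monom_le)
  next
    fix z :: complex assume "z \<in> {z. z ^ m = 1}"
    then have z: "z ^ m = 1" by simp
    then have "z \<in> ?z ` {..<m}"
      using bij_betw_roots_unity[OF assms] by (auto simp: bij_betw_def)
    then have "poly (\<Prod>k\<in>{..<m}. [:- ?z k, 1:]) z = 0"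
      by (auto simp: poly_prod)
    with z show "poly (\<Prod>k\<in>{..<m}. [:- ?z k, 1:]) z = poly ?R z"
      by (simp add: poly_monom)
  qed
  finally show ?thesis .
qed

lemma prod_cyclotomic_complex:
  assumes "m > 0"
  shows "(\<Prod>d | d dvd m. cyclotomic_complex d) = monom 1 m - 1"
proof -
  let ?f = "\<lambda>m k. [:- cis (2 * pi * real k / real m), 1:]"
  have fin: "finite {d. d dvd m}" using assms by simp
  have "(\<Prod>d | d dvd m. cyclotomic_complex d)
      = (\<Prod>(d,k)\<in>(SIGMA d:{d. d dvd m}. {k \<in> {1..d}. coprime k d}). ?f d k)"
    unfolding cyclotomic_complex_def using fin by (subst prod.Sigma) auto
  also have "\<dots> = (\<Prod>k\<in>{1..m}. ?f m k)"
  proof (rule prod.reindex_bij_witness[where j = "\<lambda>(d,k). k * (m div d)"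
        and i = "\<lambda>k. (m div gcd k m, k div gcd k m)"])
    fix a assume a: "a \<in> (SIGMA d:{d. d dvd m}. {k \<in> {1..d}. coprime k d})"
    obtain d k where [simp]: "a = (d, k)" by (cases a)
    from a have dk: "d dvd m" "1 \<le> k" "k \<le> d" "coprime k d" by auto
    then obtain e where e: "m = d * e" by (elim dvdE)
    have pos: "d > 0" "e > 0" using assms e by (auto intro: Nat.gr0I)
    have g: "gcd (k * e) (d * e) = e"
      using dk(4) by (simp add: gcd_mult_distrib_nat[symmetric] mult.commute[of _ e] coprime_iff_gcd_eq_1)
    show "(case a of (d, k) \<Rightarrow> k * (m div d)) \<in> {1..m}"
      using dk pos by (auto simp: e Suc_le_eq)
    show "(m div gcd (case a of (d, k) \<Rightarrow> k * (m div d)) m,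
           (case a of (d, k) \<Rightarrow> k * (m div d)) div gcd (case a of (d, k) \<Rightarrow> k * (m div d)) m) = a"
      using pos g by (simp add: e)
    show "?f m (case a of (d, k) \<Rightarrow> k * (m div d)) = (case a of (d, k) \<Rightarrow> ?f d k)"
      using pos by (simp add: e field_simps)
  next
    fix k assume k: "k \<in> {1..m}"
    have gp: "gcd k m > 0" using assms by simp
    have "m div (m div gcd k m) = gcd k m"
      using assms by (metis dvd_div_eq_mult dvd_mult_div_cancel gcd_dvd2 gcd_nat.absorb_iff1
          nat_neq_iff nonzero_mult_div_cancel_right div_by_0 mult_is_0)
    then show "(case (m div gcd k m, k div gcd k m) of (d, k) \<Rightarrow> k * (m div d)) = k" by simp
    have "k div gcd k m > 0" using k gp by (simp add: div_greater_zero_iff gcd_le1_nat)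
    moreover have "coprime (k div gcd k m) (m div gcd k m)"
      using assms by (intro div_gcd_coprime) auto
    moreover have "k div gcd k m \<le> m div gcd k m" using k by (intro div_le_mono) auto
    moreover have "m div gcd k m dvd m"
      by (metis dvd_mult_div_cancel dvd_triv_right gcd_dvd2)
    ultimately show "(m div gcd k m, k div gcd k m)
        \<in> (SIGMA d:{d. d dvd m}. {k \<in> {1..d}. coprime k d})" by simp
  qed
  also have "\<dots> = monom 1 m - 1" by (rule prod_roots_of_unity[OF assms])
  finally show ?thesis .
qed

lemma cyclotomic_complex_integral:
  "\<exists>p. map_poly of_int p = cyclotomic_complex m \<and> lead_coeff p = 1"
proof (induction m rule: less_induct)
  case (less m)
  show ?case
  proof (cases "m = 0")
    case True
    then show ?thesis by (intro exI[of _ 1]) (simp add: cyclotomic_complex_def)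
  next
    case False
    define D where "D = {d. d dvd m \<and> d \<noteq> m}"
    have fin: "finite D" using False by (auto simp: D_def)
    have "\<forall>d\<in>D. \<exists>p. map_poly of_int p = cyclotomic_complex d \<and> lead_coeff p = 1"
      using less False by (auto simp: D_def dest!: dvd_imp_le)
    then obtain f where f: "\<And>d. d \<in> D \<Longrightarrow> map_poly of_int (f d) = cyclotomic_complex d"
        "\<And>d. d \<in> D \<Longrightarrow> lead_coeff (f d) = 1" by metis
    define P where "P = (\<Prod>d\<in>D. f d)"
    define P' :: "complex poly" where "P' = map_poly of_int P"
    have lP: "lead_coeff P = 1" using f(2) by (simp add: P_def lead_coeff_prod)
    then have P0: "P \<noteq> 0" by auto
    have P'_eq: "P' = (\<Prod>d\<in>D. cyclotomic_complex d)"
      using f(1) by (simp add: P'_def P_def map_poly_of_int_prod)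
    have degP': "degree P' = degree P"
      unfolding P'_def by (rule degree_map_poly) simp
    have P'0: "P' \<noteq> 0" using P0 map_poly_of_int_complex_inj[of P 0] by (auto simp: P'_def)
    have "{d. d dvd m} = insert m D" by (auto simp: D_def)
    then have eq: "cyclotomic_complex m * P' = monom 1 m - 1"
      using prod_cyclotomic_complex[of m] False fin by (simp add: P'_eq D_def)
    obtain q r where qr: "pseudo_divmod (monom 1 m - 1) P = (q, r)" by fastforce
    from pseudo_divmod[OF P0 qr] lP
    have 1: "monom 1 m - 1 = P * q + r" and 2: "r = 0 \<or> degree r < degree P" by simp_all
    have mm: "map_poly of_int (monom 1 m - 1 :: int poly) = (monom 1 m - 1 :: complex poly)"
      by (rule poly_eqI) (simp add: coeff_map_poly)
    have "(monom 1 m - 1 :: complex poly) = P' * map_poly of_int q + map_poly of_int r"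
      unfolding P'_def mm[symmetric] 1 by (simp add: map_poly_of_int_add map_poly_of_int_mult)
    with eq have e: "P' * (cyclotomic_complex m - map_poly of_int q) = map_poly of_int r"
      by (simp add: algebra_simps)
    have "r = 0"
    proof (rule ccontr)
      assume r: "r \<noteq> 0"
      then have dr: "degree r < degree P" using 2 by simp
      have "degree (map_poly of_int r :: complex poly) = degree r"
        by (rule degree_map_poly) simp
      moreover have "(map_poly of_int r :: complex poly) \<noteq> 0"
        using r map_poly_of_int_complex_inj[of r 0] by auto
      then have "cyclotomic_complex m - map_poly of_int q \<noteq> 0" using e by auto
      then have "degree (P' * (cyclotomic_complex m - map_poly of_int q)) \<ge> degree P'"
        using P'0 by (simp add: degree_mult_eq)
      ultimately show False using e dr degP' by simp
    qed
    with e P'0 have m: "map_poly of_int q = cyclotomic_complex m" by simp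
    have "complex_of_int (lead_coeff q) = lead_coeff (cyclotomic_complex m)"
      unfolding m[symmetric] by (subst degree_map_poly) (auto simp: coeff_map_poly)
    then have "lead_coeff q = 1" by (simp add: lead_coeff_cyclotomic_complex)
    with m show ?thesis by blast
  qed
qed

lemma of_int_poly_cyclotomic_int: "map_poly of_int (cyclotomic_int m) = cyclotomic_complex m"
proof -
  obtain p where p: "map_poly of_int p = cyclotomic_complex m"
    using cyclotomic_complex_integral by blast
  show ?thesis
    unfolding cyclotomic_int_def
    by (rule theI[of _ p]) (auto simp: p intro: map_poly_of_int_complex_inj)
qed


subsection \<open>Trace and norm take values in the small field\<close>

lemma field_embedding_0: "field_embedding h \<Longrightarrow> h 0 = 0"
  unfolding field_embedding_def by (metis add_cancel_right_left)

lemma field_embedding_diff: "field_embedding h \<Longrightarrow> h (x - y) = h x - h y"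
  unfolding field_embedding_def by (metis add_diff_cancel diff_add_cancel)

lemma field_embedding_inj:
  assumes "field_embedding h"
  shows "inj h"
proof (rule injI, rule ccontr)
  fix x y assume xy: "h x = h y" "x \<noteq> y"
  have "1 = h ((x - y) * inverse (x - y))" using assms xy(2) by (simp add: field_embedding_def)
  also have "\<dots> = h (x - y) * h (inverse (x - y))" using assms by (simp add: field_embedding_def)
  also have "\<dots> = 0" using field_embedding_diff[OF assms] xy(1) by simp
  finally show False by simp
qed

lemma field_embedding_of_nat: "field_embedding h \<Longrightarrow> h (of_nat n) = of_nat n"
  by (induction n) (simp_all add: field_embedding_0, simp add: field_embedding_def)

lemma field_embedding_power: "field_embedding h \<Longrightarrow> h (x ^ n) = h x ^ n"
  by (induction n) (simp_all add: field_embedding_def)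

lemma of_nat_card_eq_0: "of_nat CARD('a) = (0 :: 'a::finite_field)"
proof -
  have "(\<Sum>x\<in>UNIV. x + 1) = (\<Sum>x\<in>UNIV. x :: 'a)"
    by (rule sum.reindex_bij_witness[where i = "\<lambda>x. x - 1" and j = "\<lambda>x. x + 1"]) auto
  then show ?thesis by (simp add: sum.distrib)
qed

lemma mem_range_embedding:
  fixes h :: "'a::finite_field \<Rightarrow> 'b::field"
  assumes h: "field_embedding h" and y: "y ^ CARD('a) = y"
  shows "y \<in> range h"
proof -
  let ?q = "CARD('a)"
  let ?p = "monom 1 ?q - monom 1 1 :: 'b poly"
  have q1: "?q > 1"
    using card_mono[of UNIV "{0, 1 :: 'a}"] by simp
  have "coeff ?p ?q = 1" using q1 by simp
  then have p0: "?p \<noteq> 0" by (metis coeff_0 zero_neq_one)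
  have fin: "finite {x. poly ?p x = 0}" using p0 by (rule poly_roots_finite)
  have "card {x. poly ?p x = 0} \<le> degree ?p" by (rule card_poly_roots_bound[OF p0])
  also have "\<dots> \<le> ?q" using q1 by (intro degree_diff_le) (auto simp: degree_monom_eq)
  also have "\<dots> = card (range h)" using field_embedding_inj[OF h] by (simp add: card_image)
  finally have c: "card {x. poly ?p x = 0} \<le> card (range h)" .
  have "range h \<subseteq> {x. poly ?p x = 0}"
    using finite_field_power_card_eq_same[where ?'a = 'a]
    by (auto simp: poly_monom field_embedding_power[OF h, symmetric])
  then have "range h = {x. poly ?p x = 0}" using c fin by (intro card_seteq) auto
  then show ?thesis using y by (simp add: poly_monom)
qed

lemma field_embedding_the:
  fixes h :: "'a::finite_field \<Rightarrow> 'b::field"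
  assumes h: "field_embedding h" and y: "y ^ CARD('a) = y"
  shows "h (THE x. h x = y) = y"
proof -
  obtain x where x: "y = h x" using mem_range_embedding[OF assms] by auto
  show ?thesis
    by (rule theI[of _ x]) (use x field_embedding_inj[OF h] in \<open>auto dest: injD\<close>)
qed

lemma power_card_power_card:
  fixes x :: "'b::finite_field"
  assumes "CARD('b) = q ^ 2"
  shows "(x ^ q) ^ q = x"
  using finite_field_power_card_eq_same[of x] assms
  by (simp add: power_mult[symmetric] power2_eq_square)

lemma embed_quad_trace:
  fixes h :: "'a::finite_field \<Rightarrow> 'b::finite_field"
  assumes h: "field_embedding h" and "prime CARD('a)" and "CARD('b) = CARD('a) ^ 2"
  shows "h (quad_trace h x) = x + x ^ CARD('a)"
proof -
  have "of_nat CARD('a) = (0::'b)"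
    using field_embedding_of_nat[OF h, of "CARD('a)"] of_nat_card_eq_0[where ?'a = 'a]
      field_embedding_0[OF h] by simp
  then have "CHAR('b) dvd CARD('a)" by (simp add: of_nat_eq_0_iff_char_dvd)
  then have C: "CARD('a) = CHAR('b)"
    using assms(2) by (metis CHAR_prime primes_dvd_imp_eq)
  have "(x + x ^ CARD('a)) ^ CARD('a) = x ^ CARD('a) + (x ^ CARD('a)) ^ CARD('a)"
    by (rule freshmans_dream[OF CHAR_prime C])
  also have "\<dots> = x + x ^ CARD('a)"
    by (simp only: power_card_power_card[OF assms(3)] add.commute)
  finally show ?thesis
    unfolding quad_trace_def by (rule field_embedding_the[OF h])
qed

lemma embed_quad_chi:
  fixes h :: "'a::finite_field \<Rightarrow> 'b::finite_field"
  assumes h: "field_embedding h" and "CARD('b) = CARD('a) ^ 2"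
  shows "h (quad_chi h x) = x ^ (CARD('a) + 1)"
proof -
  have "(x ^ (CARD('a) + 1)) ^ CARD('a) = (x ^ CARD('a)) ^ CARD('a) * x ^ CARD('a)"
    by (simp add: power_mult_distrib mult.commute)
  also have "\<dots> = x ^ (CARD('a) + 1)"
    by (simp only: power_card_power_card[OF assms(2)] power_add power_one_right mult.commute)
  finally show ?thesis
    unfolding quad_chi_def by (rule field_embedding_the[OF h])
qed

end

theory Submission
  imports Defs
begin

text \<open>
  Write \<open>Z = x ^ (2 ^ (n - 1))\<close>. The classical recursion for cyclotomic polynomials gives
  \<open>(Z + 1) * cyclotomic (2 ^ n * t) = Z ^ t + 1\<close> over every commutative ring
  (\<open>cyclotomic_two_power_times_prime\<close>). If a field contains an element \<open>w \<noteq> 1\<close> with \<open>w ^ t = 1\<close>,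
  then, as \<open>t\<close> is an odd prime, \<open>Z ^ t + 1\<close> is the product of all \<open>Z + w ^ j\<close> with \<open>j < t\<close>;
  cancelling the factor \<open>Z + 1\<close>, which belongs to \<open>j = 0\<close>, leaves a factorization into the \<open>t - 1\<close>
  binomials \<open>Z + w ^ j\<close> (\<open>cyclotomic_two_power_times_prime_eq_prod\<close>). Both parts come from a good
  choice of \<open>w\<close> as a power of 2, followed by a splitting of each binomial.

  If \<open>q = 4 * t + 1\<close>, then \<open>16 ^ t = 2 ^ (q - 1) = 1\<close>, so \<open>w = 256\<close> is allowed. With
  \<open>y = x ^ (2 ^ (n - 2))\<close> and \<open>s ^ 2 = -1\<close> the binomial is the difference of squares
  \<open>y ^ 2 + 256 ^ j = y ^ 2 - (s * 16 ^ j) ^ 2\<close>.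

  If \<open>q = 2 * t + 1\<close>, then \<open>4 ^ t = 1\<close>. Put \<open>N = 2 ^ (k - 3)\<close> and \<open>Y = x ^ (2 ^ (n - k))\<close>, so that
  \<open>Z = Y ^ (4 * N)\<close>, and take \<open>w = 4 ^ (4 * N)\<close>. The task is now to split
  \<open>Y ^ (4 * N) + c ^ (4 * N)\<close> for \<open>c = 4 ^ j\<close>, and this is what the product over \<open>i\<close> does. Over the
  quadratic extension its roots are \<open>c\<close> times the primitive \<open>8 * N\<close>-th roots of unity. Since
  \<open>4 * N\<close> divides \<open>q + 1\<close>, the \<open>q\<close>-th power map sends each such root of unity to its inverse up to
  sign. Hence the roots fall into quadruples consisting of \<open>c * r\<close> and \<open>c * r ^ q\<close> with either
  sign, where \<open>r = \<beta> ^ (2 * i - 1)\<close>. The two quadratics with coefficients in the small field that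
  vanish on a quadruple are \<open>Y ^ 2 \<plusminus> c * (r + r ^ q) * Y + r ^ (q + 1) * c ^ 2\<close>, and
  \<open>r ^ (q + 1) = \<beta> ^ (q + 1)\<close> because \<open>\<beta> ^ (q + 1)\<close> is a sign and \<open>2 * i - 1\<close> is odd. The identity is
  verified in the big field and pulled back along the embedding (\<open>prod_quad_trace_factors\<close>).
\<close>

section \<open>Powers of roots of unity\<close>

lemma const_poly_minus: "[:- a:] = - [:a:]"
  by simp

lemma primitive_root_imp_inj:
  fixes z :: "'a::field"
  assumes z: "primitive_root_of_unity m z"
  shows "inj_on (\<lambda>j. z ^ j) {..<m}"
proof (rule linorder_inj_onI)
  fix i j assume ij: "i < j" "i \<in> {..<m}" "j \<in> {..<m}"
  have z0: "z \<noteq> 0"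
    using z by (auto simp: primitive_root_of_unity_def power_0_left)
  have "z ^ j = z ^ i * z ^ (j - i)"
    using ij by (simp flip: power_add)
  moreover have "z ^ (j - i) \<noteq> 1"
    using z ij by (auto simp: primitive_root_of_unity_def)
  ultimately show "z ^ i \<noteq> z ^ j"
    using z0 by auto
qed auto

lemma power_eq_1_coprime:
  fixes z :: "'a::monoid_mult"
  assumes "z ^ a = 1" "z ^ b = 1" "coprime a b" "a \<noteq> 0"
  shows "z = 1"
proof -
  obtain x y where "a * x = b * y + 1"
    using bezout_nat[of a b] assms(3,4) by auto
  then have "z ^ (a * x) = z ^ (b * y) * z"
    by (simp add: power_add power_commutes)
  then show ?thesis
    using assms(1,2) by (simp add: power_mult)
qed

lemma primitive_root_prime:
  fixes z :: "'a::field"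
  assumes "prime t" "z ^ t = 1" "z \<noteq> 1"
  shows "primitive_root_of_unity t z"
  unfolding primitive_root_of_unity_def
proof (intro conjI allI impI)
  show "t > 0" using assms(1) by (rule prime_gt_0_nat)
  fix l assume l: "0 < l \<and> l < t"
  then have "coprime l t"
    using assms(1) by (meson coprime_commute nat_dvd_not_less prime_imp_coprime)
  then show "z ^ l \<noteq> 1"
    using power_eq_1_coprime[of z l t] assms(2,3) l by auto
qed (use assms in auto)

lemma primitive_root_power_dvd:
  fixes z :: "'a::field"
  assumes "primitive_root_of_unity (d * m) z"
  shows "primitive_root_of_unity m (z ^ d)"
  using assms unfolding primitive_root_of_unity_def by (auto simp flip: power_mult)

lemma primitive_root_half:
  fixes z :: "'a::field"
  assumes "primitive_root_of_unity (2 * m) z"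
  shows "z ^ m = -1"
proof -
  have m: "m > 0" "z ^ (2 * m) = 1" "z ^ m \<noteq> 1"
    using assms by (auto simp: primitive_root_of_unity_def)
  then have "(z ^ m) ^ 2 = 1"
    by (simp add: mult.commute flip: power_mult)
  with m(3) show ?thesis by (simp add: power2_eq_1_iff)
qed

text \<open>Both sides are monic of degree \<open>m\<close> in an indeterminate and vanish at the \<open>m\<close> distinct points
  \<open>z ^ j * b\<close>. Allowing an arbitrary polynomial \<open>X\<close> makes the identity applicable to powers of the
  indeterminate.\<close>

lemma prod_minus_roots_of_unity:
  fixes z b :: "'a::field" and X :: "'a poly"
  assumes z: "primitive_root_of_unity m z" and b: "b \<noteq> 0"
  shows "(\<Prod>j<m. X - [:z ^ j * b:]) = X ^ m - [:b ^ m:]"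
proof -
  let ?L = "\<Prod>j<m. [:- (z ^ j * b), 1:]" and ?R = "[:0, 1:] ^ m - [:b ^ m:]"
  have m: "m > 0" "z ^ m = 1"
    using z by (auto simp: primitive_root_of_unity_def)
  have d: "degree ?L = m"
    by (subst degree_prod_eq_sum_degree) auto
  have "?L = ?R"
  proof (rule poly_eqI_degree_lead_coeff[where n = m and A = "(\<lambda>j. z ^ j * b) ` {..<m}"])
    have "lead_coeff ?L = 1" by (simp add: lead_coeff_prod)
    then show "coeff ?L m = coeff ?R m"
      using d m by (simp add: coeff_pCons coeff_linear_power split: nat.split)
    have "inj_on (\<lambda>j. z ^ j * b) {..<m}"
      using primitive_root_imp_inj[OF z] b by (auto simp: inj_on_def)
    then show "m \<le> card ((\<lambda>j. z ^ j * b) ` {..<m})" by (simp add: card_image)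
    show "degree ?R \<le> m" by (intro degree_diff_le) (auto simp: degree_linear_power)
    fix x assume "x \<in> (\<lambda>j. z ^ j * b) ` {..<m}"
    then obtain j where j: "j < m" "x = z ^ j * b" by auto
    have "x ^ m = (z ^ m) ^ j * b ^ m"
      by (simp add: j power_mult_distrib mult.commute flip: power_mult)
    moreover have "poly ?L x = 0"
      using j by (auto simp: poly_prod)
    ultimately show "poly ?L x = poly ?R x"
      using m by simp
  qed (use d in simp)
  then have "pcompose ?L X = pcompose ?R X" by simp
  moreover have pow: "pcompose (p ^ n) X = pcompose p X ^ n" for p and n :: nat
    by (induction n) (simp_all add: pcompose_mult pcompose_1)
  ultimately show ?thesis
    by (simp add: pcompose_prod pow pcompose_pCons pcompose_diff const_poly_minus del: minus_pCons)
qed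

text \<open>This is \<open>prod_minus_roots_of_unity\<close> at \<open>b = -1\<close>: the sign survives in \<open>(-1) ^ t\<close> as \<open>t\<close> is odd.
  The factor for \<open>j = 0\<close> is separated because it is the one that cancels in the cyclotomic
  polynomial.\<close>

lemma prod_plus_prime_roots_of_unity:
  fixes w :: "'a::field" and Z :: "'a poly"
  assumes "prime t" "odd t" "w ^ t = 1" "w \<noteq> 1"
  shows "(\<Prod>j\<in>{1..t-1}. Z + [:w ^ j:]) * (Z + 1) = Z ^ t + 1"
proof -
  have t: "t > 0" using assms(1) by (rule prime_gt_0_nat)
  have "(\<Prod>j<t. Z - [:w ^ j * - 1:]) = Z ^ t - [:(-1) ^ t:]"
    by (rule prod_minus_roots_of_unity) (use primitive_root_prime assms in auto)
  then have "(\<Prod>j<t. Z + [:w ^ j:]) = Z ^ t + 1"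
    using assms(2) by (simp add: const_poly_minus del: minus_pCons flip: one_pCons)
  moreover have "{..<t} = insert 0 {1..t-1}" using t by auto
  ultimately show ?thesis by (simp add: mult.commute one_pCons)
qed

text \<open>The exponents \<open>2 * i - 1\<close> and \<open>4 * N - (2 * i - 1)\<close> for \<open>1 \<le> i \<le> N\<close> run through all odd residues
  modulo \<open>4 * N\<close>. So the left-hand side has the roots \<open>b * g * (g ^ 2) ^ i\<close> with \<open>i < 2 * N\<close>, that is,
  \<open>b * g\<close> times the \<open>2 * N\<close>-th roots of unity, and \<open>g ^ (2 * N) = -1\<close> turns the difference of powers
  into a sum.\<close>

lemma prod_odd_powers:
  fixes g b :: "'a::field" and W :: "'a poly"
  assumes g: "primitive_root_of_unity (4 * N) g" and b: "b \<noteq> 0"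
  shows "(\<Prod>i\<in>{1..N}. (W - [:b * g ^ (2 * i - 1):]) * (W - [:b * inverse (g ^ (2 * i - 1)):]))
    = W ^ (2 * N) + [:b ^ (2 * N):]"
proof -
  let ?f = "\<lambda>i. W - [:b * g ^ (2 * i - 1):]"
  have N: "N > 0" "g ^ (4 * N) = 1" and g0: "g \<noteq> 0"
    using g by (auto simp: primitive_root_of_unity_def power_0_left)
  have inv: "inverse (g ^ (2 * i - 1)) = g ^ (2 * (2 * N + 1 - i) - 1)" if "i \<in> {1..N}" for i
  proof -
    have "2 * i - 1 + (2 * (2 * N + 1 - i) - 1) = 4 * N" using that by auto
    then have "g ^ (2 * i - 1) * g ^ (2 * (2 * N + 1 - i) - 1) = 1"
      using N by (simp flip: power_add)
    then show ?thesis by (rule inverse_unique)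
  qed
  have "(\<Prod>i\<in>{1..N}. ?f i * (W - [:b * inverse (g ^ (2 * i - 1)):]))
      = (\<Prod>i\<in>{1..N}. ?f i * ?f (2 * N + 1 - i))"
    by (intro prod.cong refl) (simp only: inv)
  also have "\<dots> = (\<Prod>i\<in>{1..N}. ?f i) * (\<Prod>i\<in>{1..N}. ?f (2 * N + 1 - i))"
    by (rule prod.distrib)
  also have "(\<Prod>i\<in>{1..N}. ?f (2 * N + 1 - i)) = (\<Prod>i\<in>{N+1..2*N}. ?f i)"
    by (rule prod.reindex_bij_witness[where i = "\<lambda>i. 2 * N + 1 - i" and j = "\<lambda>i. 2 * N + 1 - i"])
      auto
  also have "(\<Prod>i\<in>{1..N}. ?f i) * \<dots> = (\<Prod>i\<in>{1..2*N}. ?f i)"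
    using prod.ub_add_nat[of 1 N ?f N] by (simp add: mult_2)
  also have "\<dots> = (\<Prod>i<2*N. W - [:(g ^ 2) ^ i * (b * g):])"
    unfolding One_nat_def prod.atLeast1_atMost_eq
    by (intro prod.cong refl) (simp add: ac_simps flip: power_mult)
  also have "\<dots> = W ^ (2 * N) - [:(b * g) ^ (2 * N):]"
    using primitive_root_power_dvd[of 2 "2 * N" g] g b g0
    by (intro prod_minus_roots_of_unity) auto
  also have "(b * g) ^ (2 * N) = - (b ^ (2 * N))"
    using primitive_root_half[of "2 * N" g] g by (simp add: power_mult_distrib)
  finally show ?thesis by (simp add: const_poly_minus del: minus_pCons)
qed

section \<open>The cyclotomic polynomial of index \<open>2 ^ n * t\<close>\<close>

lemma monom_minus_1_nonzero: "m > 0 \<Longrightarrow> monom 1 m - 1 \<noteq> (0 :: 'a::comm_ring_1 poly)"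
  by (auto simp: poly_eq_iff intro!: exI[of _ 0])

text \<open>Doubling the index contributes the factor \<open>x ^ m + 1\<close>, which both cyclotomic
  computations below compare with the divisors of the doubled index that do not divide the old one.\<close>

lemma monom_double_minus_1: "monom 1 (2 * m) - 1 = (monom 1 m + 1) * (monom 1 m - 1 :: complex poly)"
  by (simp add: algebra_simps mult_monom flip: mult_2)

lemma cyclotomic_complex_two_power:
  "cyclotomic_complex (2 ^ Suc n) = monom 1 (2 ^ n) + 1"
proof -
  have "{d::nat. d dvd 2 ^ Suc n} = insert (2 ^ Suc n) {d. d dvd 2 ^ n}"
    by (auto simp: divides_primepow_nat le_Suc_eq simp del: power_Suc)
  moreover have "(2::nat) ^ Suc n \<notin> {d. d dvd 2 ^ n}"
    by (auto dest: dvd_imp_le)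
  ultimately have "cyclotomic_complex (2 ^ Suc n) * (monom 1 (2 ^ n) - 1) = monom 1 (2 ^ Suc n) - 1"
    using prod_cyclotomic_complex[of "2 ^ Suc n"] prod_cyclotomic_complex[of "2 ^ n"] by simp
  also have "\<dots> = (monom 1 (2 ^ n) + 1) * (monom 1 (2 ^ n) - 1)"
    using monom_double_minus_1[of "2 ^ n"] by simp
  finally show ?thesis
    using monom_minus_1_nonzero[of "2 ^ n", where ?'a = complex] by simp
qed

text \<open>The divisors of \<open>2 ^ Suc n * t\<close> that do not divide \<open>2 ^ n * t\<close> are \<open>2 ^ Suc n\<close> and \<open>2 ^ Suc n * t\<close>.
  Dividing \<open>x ^ (2 ^ Suc n * t) - 1\<close> by \<open>x ^ (2 ^ n * t) - 1\<close> therefore leaves the product of these two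
  cyclotomic polynomials, the first of which is \<open>x ^ (2 ^ n) + 1\<close>.\<close>

lemma cyclotomic_complex_two_power_times_prime:
  assumes t: "prime t" "odd t"
  shows "cyclotomic_complex (2 ^ Suc n * t) * (monom 1 (2 ^ n) + 1) = monom 1 (2 ^ n * t) + 1"
proof -
  have t1: "t > 1" using t(1) by (rule prime_gt_1_nat)
  have div: "{d. d dvd 2 ^ m * t} = {d. d dvd 2 ^ m} \<union> (\<lambda>d. d * t) ` {d. d dvd 2 ^ m}" for m
  proof (intro subset_antisym subsetI)
    fix d assume "d \<in> {d. d dvd 2 ^ m * t}"
    then obtain a b where ab: "d = a * b" "a dvd 2 ^ m" "b dvd t"
      using division_decomp[of d "2 ^ m" t] by auto
    then have "b = 1 \<or> b = t" using t(1) by (auto simp: prime_nat_iff)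
    then show "d \<in> {d. d dvd 2 ^ m} \<union> (\<lambda>d. d * t) ` {d. d dvd 2 ^ m}"
      using ab by auto
  qed (auto intro: mult_dvd_mono)
  have ins: "{d::nat. d dvd 2 ^ Suc n} = insert (2 ^ Suc n) {d. d dvd 2 ^ n}"
    by (auto simp: divides_primepow_nat le_Suc_eq simp del: power_Suc)
  have "{d. d dvd 2 ^ Suc n * t} = insert (2 ^ Suc n * t) (insert (2 ^ Suc n) {d. d dvd 2 ^ n * t})"
    unfolding div ins by auto
  moreover have "\<not> 2 ^ Suc n dvd 2 ^ n * t" "\<not> 2 ^ Suc n * t dvd 2 ^ n * t"
    using t(2) t1 by (auto simp: dvd_def)
  moreover have "2 ^ Suc n * t \<noteq> 2 ^ Suc n" using t1 by simp
  moreover have "finite {d. d dvd 2 ^ n * t}" using t1 by simp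
  ultimately have "cyclotomic_complex (2 ^ Suc n * t) * (cyclotomic_complex (2 ^ Suc n) *
      (monom 1 (2 ^ n * t) - 1)) = monom 1 (2 ^ Suc n * t) - 1"
    using prod_cyclotomic_complex[of "2 ^ Suc n * t"] prod_cyclotomic_complex[of "2 ^ n * t"] t1
    by (simp del: power_Suc)
  also have "\<dots> = (monom 1 (2 ^ n * t) + 1) * (monom 1 (2 ^ n * t) - 1)"
    using monom_double_minus_1[of "2 ^ n * t"] by (simp add: mult.assoc)
  finally show ?thesis
    using monom_minus_1_nonzero[of "2 ^ n * t", where ?'a = complex] t1
    by (simp add: cyclotomic_complex_two_power del: power_Suc flip: mult.assoc)
qed

text \<open>An identity between integer polynomials: it is inherited from the complex numbers by injectivity,
  and then by every commutative ring through reduction of coefficients.\<close>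

lemma cyclotomic_two_power_times_prime:
  assumes "prime t" "odd t"
  shows "cyclotomic (2 ^ Suc n * t) * (monom 1 (2 ^ n) + 1)
    = (monom 1 (2 ^ n) ^ t + 1 :: 'a::comm_ring_1 poly)"
proof -
  have m: "map_poly of_int (monom 1 a + 1 :: int poly) = (monom 1 a + 1 :: 'b::comm_ring_1 poly)" for a
    by (rule poly_eqI) (simp add: coeff_map_poly)
  have "cyclotomic_int (2 ^ Suc n * t) * (monom 1 (2 ^ n) + 1) = monom 1 (2 ^ n * t) + 1"
    by (rule map_poly_of_int_complex_inj)
      (simp only: map_poly_of_int_mult m of_int_poly_cyclotomic_int
         cyclotomic_complex_two_power_times_prime[OF assms])
  from arg_cong[OF this, of "map_poly of_int :: _ \<Rightarrow> 'a poly"] show ?thesis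
    by (simp only: map_poly_of_int_mult m monom_power cyclotomic_def power_one)
qed

text \<open>Both sides become \<open>Z ^ t + 1\<close> with \<open>Z = x ^ (2 ^ n)\<close> after multiplication by \<open>Z + 1\<close>, which is not a
  zero divisor over a field.\<close>

lemma cyclotomic_two_power_times_prime_eq_prod:
  fixes w :: "'a::field"
  assumes t: "prime t" "odd t" and w: "w ^ t = 1" "w \<noteq> 1"
  shows "cyclotomic (2 ^ Suc n * t) = (\<Prod>j\<in>{1..t-1}. monom 1 (2 ^ n) + [:w ^ j:])"
proof -
  have "coeff (monom 1 (2 ^ n) + 1 :: 'a poly) 0 = 1" by simp
  then have "monom 1 (2 ^ n) + 1 \<noteq> (0 :: 'a poly)" by (metis coeff_0 zero_neq_one)
  moreover have "cyclotomic (2 ^ Suc n * t) * (monom 1 (2 ^ n) + 1)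
      = (\<Prod>j\<in>{1..t-1}. monom 1 (2 ^ n) + [:w ^ j:]) * (monom 1 (2 ^ n) + 1)"
    unfolding cyclotomic_two_power_times_prime[OF t] prod_plus_prime_roots_of_unity[OF t w] ..
  ultimately show ?thesis by (auto simp only: mult_cancel_right)
qed

section \<open>Descending a factorization along a field embedding\<close>

lemma field_embedding_sum:
  "field_embedding h \<Longrightarrow> h (sum f A) = (\<Sum>x\<in>A. h (f x))"
  by (induction A rule: infinite_finite_induct) (auto simp: field_embedding_0, simp add: field_embedding_def)

lemma map_poly_embedding_add:
  "field_embedding h \<Longrightarrow> map_poly h (p + q) = map_poly h p + map_poly h q"
  by (rule poly_eqI) (simp add: coeff_map_poly field_embedding_0, simp add: field_embedding_def)

lemma map_poly_embedding_diff:
  "field_embedding h \<Longrightarrow> map_poly h (p - q) = map_poly h p - map_poly h q"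
  by (rule poly_eqI) (simp add: coeff_map_poly field_embedding_0 field_embedding_diff)

lemma map_poly_embedding_mult:
  "field_embedding h \<Longrightarrow> map_poly h (p * q) = map_poly h p * map_poly h q"
  by (rule poly_eqI)
    (simp add: coeff_map_poly coeff_mult field_embedding_0 field_embedding_sum,
     simp add: field_embedding_def)

lemma map_poly_embedding_const:
  "field_embedding h \<Longrightarrow> map_poly h [:c:] = [:h c:]"
  by (rule poly_eqI) (simp add: coeff_map_poly field_embedding_0 coeff_pCons split: nat.split)

lemma map_poly_embedding_monom:
  "field_embedding h \<Longrightarrow> map_poly h (monom c n) = monom (h c) n"
  by (rule poly_eqI) (simp add: coeff_map_poly field_embedding_0)

lemma map_poly_embedding_prod:
  assumes h: "field_embedding h"
  shows "map_poly h (prod f A) = (\<Prod>x\<in>A. map_poly h (f x))"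
proof -
  have "h 1 = 1" using h by (simp add: field_embedding_def)
  then have "map_poly h 1 = 1"
    by (simp add: one_pCons map_poly_embedding_const[OF h])
  then show ?thesis
    by (induction A rule: infinite_finite_induct) (auto simp: map_poly_embedding_mult[OF h])
qed

lemma map_poly_embedding_eqD:
  assumes h: "field_embedding h" and eq: "map_poly h p = map_poly h q"
  shows "p = q"
proof (rule poly_eqI)
  fix n
  have "h (coeff p n) = h (coeff q n)"
    using arg_cong[OF eq, of "\<lambda>p. coeff p n"] by (simp add: coeff_map_poly field_embedding_0[OF h])
  then show "coeff p n = coeff q n"
    using field_embedding_inj[OF h] by (rule injD[rotated])
qed

text \<open>Both sides have the roots \<open>\<plusminus> c * r\<close> and \<open>\<plusminus> c * s\<close>; the left-hand side pairs \<open>r\<close> with \<open>s\<close>, the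
  right-hand side pairs each root with its negative.\<close>

lemma biquadratic_factorization:
  fixes c r s :: "'a::comm_ring_1" and Y :: "'a poly"
  shows "(Y ^ 2 + [:c * (r + s):] * Y + [:r * s * c ^ 2:]) * (Y ^ 2 - [:c * (r + s):] * Y + [:r * s * c ^ 2:])
    = (Y ^ 2 - [:c ^ 2 * r ^ 2:]) * (Y ^ 2 - [:c ^ 2 * s ^ 2:])"
proof -
  have "[:c * (r + s):] = [:c:] * ([:r:] + [:s:])" "[:r * s * c ^ 2:] = [:r:] * [:s:] * [:c:] ^ 2"
    "[:c ^ 2 * r ^ 2:] = [:c:] ^ 2 * [:r:] ^ 2" "[:c ^ 2 * s ^ 2:] = [:c:] ^ 2 * [:s:] ^ 2"
    by (simp_all add: power2_eq_square mult_ac)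
  then show ?thesis by (simp only:) (simp only: power2_eq_square algebra_simps)
qed

text \<open>The coefficients live in the small field while the roots live in the big one, so the identity is
  proved for the images under \<open>h\<close>. There \<open>biquadratic_factorization\<close> with \<open>r = \<beta> ^ (2 * i - 1)\<close> and
  \<open>s = r ^ q\<close> replaces the two quadratics by the factors of \<open>prod_odd_powers\<close> for \<open>g = \<beta> ^ 2\<close>; the
  divisibility of \<open>q + 1\<close> by \<open>4 * N\<close> says that \<open>q\<close>-th powers invert \<open>g\<close>.\<close>

lemma prod_quad_trace_factors:
  fixes h :: "'a::finite_field \<Rightarrow> 'b::finite_field" and \<beta> :: 'b and c :: 'a
  assumes h: "field_embedding h" and q: "prime CARD('a)" and Q: "CARD('b) = CARD('a) ^ 2"
    and \<beta>: "primitive_root_of_unity (8 * N) \<beta>" and N: "4 * N dvd CARD('a) + 1" and c: "c \<noteq> 0"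
  shows "(\<Prod>i\<in>{1..N}.
      (monom 1 (2 * M) + monom (c * quad_trace h (\<beta> ^ (2 * i - 1))) M + [:quad_chi h \<beta> * c ^ 2:]) *
      (monom 1 (2 * M) - monom (c * quad_trace h (\<beta> ^ (2 * i - 1))) M + [:quad_chi h \<beta> * c ^ 2:]))
    = monom 1 (4 * N * M) + [:c ^ (4 * N):]"
    (is "(\<Prod>i\<in>{1..N}. ?F i) = ?G")
proof (rule map_poly_embedding_eqD[OF h])
  let ?q = "CARD('a)" and ?Y = "monom 1 M :: 'b poly" and ?c = "h c"
  have h1: "h 1 = 1" and hm: "\<And>x y. h (x * y) = h x * h y"
    using h by (auto simp: field_embedding_def)
  have c0: "?c \<noteq> 0"
    using c field_embedding_inj[OF h] field_embedding_0[OF h] by (metis injD)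
  have \<gamma>: "primitive_root_of_unity (4 * N) (\<beta> ^ 2)"
    using primitive_root_power_dvd[of 2 "4 * N" \<beta>] \<beta> by simp
  \<comment> \<open>The \<open>q\<close>-th power map inverts \<open>\<beta> ^ 2\<close>.\<close>
  obtain d where d: "?q + 1 = 4 * N * d" using N by blast
  have \<gamma>q: "(\<beta> ^ 2) ^ (?q + 1) = 1"
    using \<gamma> unfolding d power_mult[of _ "4 * N"] by (simp add: primitive_root_of_unity_def)
  have F: "map_poly h (?F i) = (?Y ^ 2 - [:?c ^ 2 * (\<beta> ^ 2) ^ (2 * i - 1):]) *
      (?Y ^ 2 - [:?c ^ 2 * inverse ((\<beta> ^ 2) ^ (2 * i - 1)):])" if i: "i \<in> {1..N}" for i
  proof -
    define m where "m = 2 * i - 1"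
    define r where "r = \<beta> ^ m"
    \<comment> \<open>The exponent \<open>m\<close> is odd and \<open>\<beta> ^ (q + 1)\<close> has square 1, so raising it to the \<open>m\<close>-th power changes nothing.\<close>
    obtain l where l: "m = 2 * l + 1"
      using i by (auto simp: m_def intro: that[of "i - 1"])
    have "r * r ^ ?q = (\<beta> ^ (?q + 1)) ^ m"
      by (simp add: r_def power_mult_distrib power_add mult_ac flip: power_mult)
    also have "(\<beta> ^ e) ^ m = ((\<beta> ^ 2) ^ e) ^ l * \<beta> ^ e" for e
      by (simp add: l mult_ac flip: power_mult)
    finally have rr: "r * r ^ ?q = \<beta> ^ (?q + 1)" by (simp only: \<gamma>q power_one mult_1)
    have r2: "r ^ 2 = (\<beta> ^ 2) ^ m"
      by (simp add: r_def mult.commute flip: power_mult)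
    have "r ^ 2 * (r ^ ?q) ^ 2 = ((\<beta> ^ 2) ^ (?q + 1)) ^ 1"
      unfolding power_mult_distrib[symmetric] rr by (simp only: power_one_right mult.commute flip: power_mult)
    then have "r ^ 2 * (r ^ ?q) ^ 2 = 1" by (simp only: \<gamma>q power_one)
    then have s2: "(r ^ ?q) ^ 2 = inverse ((\<beta> ^ 2) ^ m)"
      unfolding r2 by (metis inverse_unique)
    have lin: "monom (?c * (r + r ^ ?q)) M = [:?c * (r + r ^ ?q):] * ?Y"
      by (simp add: smult_monom)
    have sq: "monom 1 (2 * M) = ?Y ^ 2"
      by (simp add: monom_power mult.commute)
    have "map_poly h (?F i) =
        (?Y ^ 2 + [:?c * (r + r ^ ?q):] * ?Y + [:r * r ^ ?q * ?c ^ 2:]) *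
        (?Y ^ 2 - [:?c * (r + r ^ ?q):] * ?Y + [:r * r ^ ?q * ?c ^ 2:])"
      by (simp only: map_poly_embedding_mult[OF h] map_poly_embedding_add[OF h]
          map_poly_embedding_diff[OF h] map_poly_embedding_const[OF h] map_poly_embedding_monom[OF h]
          hm h1 field_embedding_power[OF h] embed_quad_trace[OF h q Q] embed_quad_chi[OF h Q]
          rr lin sq flip: m_def r_def)
    then show ?thesis
      unfolding biquadratic_factorization r2 s2 m_def .
  qed
  have "map_poly h (\<Prod>i\<in>{1..N}. ?F i) = (\<Prod>i\<in>{1..N}.
      (?Y ^ 2 - [:?c ^ 2 * (\<beta> ^ 2) ^ (2 * i - 1):]) *
      (?Y ^ 2 - [:?c ^ 2 * inverse ((\<beta> ^ 2) ^ (2 * i - 1)):]))"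
    unfolding map_poly_embedding_prod[OF h] using F by (intro prod.cong refl)
  also have "\<dots> = (?Y ^ 2) ^ (2 * N) + [:(?c ^ 2) ^ (2 * N):]"
    using \<gamma> c0 by (intro prod_odd_powers) auto
  also have "\<dots> = map_poly h ?G"
    by (simp add: map_poly_embedding_add[OF h] map_poly_embedding_monom[OF h]
        map_poly_embedding_const[OF h] h1 field_embedding_power[OF h] monom_power ac_simps
        flip: power_mult)
  finally show "map_poly h (\<Prod>i\<in>{1..N}. ?F i) = map_poly h ?G" .
qed

section \<open>Numerals in a field of prime order\<close>

lemma of_nat_prime_card_eq_0_iff:
  assumes "prime CARD('a::finite_field)"
  shows "of_nat m = (0::'a) \<longleftrightarrow> CARD('a) dvd m"
proof -
  have "CHAR('a) dvd CARD('a)"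
    using of_nat_card_eq_0[where ?'a = 'a] by (simp add: of_nat_eq_0_iff_char_dvd)
  then have "CHAR('a) = CARD('a)"
    using assms by (metis CHAR_prime primes_dvd_imp_eq)
  then show ?thesis by (simp add: of_nat_eq_0_iff_char_dvd)
qed

text \<open>The multiplicative group has order \<open>CARD('a) - 1\<close>; applied to 2, this gives elements whose
  \<open>t\<close>-th power is 1.\<close>

lemma power_card_minus_1:
  fixes x :: "'a::finite_field"
  assumes "x \<noteq> 0"
  shows "x ^ (CARD('a) - 1) = 1"
proof -
  have "CARD('a) > 0" by simp
  then have "x ^ (CARD('a) - 1) * x = 1 * x"
    using finite_field_power_card_eq_same[of x] by (simp flip: power_Suc2)
  then show ?thesis using assms by (auto simp only: mult_cancel_right)
qed

section \<open>The factorizations\<close>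

text \<open>The element \<open>w = 16 ^ 2\<close> is chosen so that \<open>- w ^ j = (s * 16 ^ j) ^ 2\<close> is a square.\<close>

lemma cyclotomic_factorization_4t:
  fixes s :: "'a::finite_field"
  assumes q: "prime CARD('a)" "CARD('a) = 4 * t + 1" and t: "prime t" "odd t"
    and s: "s ^ 2 = -1" and n: "n \<ge> 2"
  shows "cyclotomic (2 ^ n * t) = (\<Prod>j\<in>{1..t-1}.
    (monom 1 (2 ^ (n - 2)) + [:s * 16 ^ j:]) * (monom 1 (2 ^ (n - 2)) - [:s * 16 ^ j:]))"
proof -
  have t1: "t > 1" using t(1) by (rule prime_gt_1_nat)
  have "(2::'a) \<noteq> 0"
    using of_nat_prime_card_eq_0_iff[OF q(1), of 2] q(2) t1 by (auto dest: dvd_imp_le)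
  then have "(2::'a) ^ (4 * t) = 1"
    using power_card_minus_1[of "2::'a"] q(2) by simp
  then have w: "(16::'a) ^ t = 1" by (simp add: power_mult)
  \<comment> \<open>If 16 were 1 then \<open>q\<close> would divide 15, but 3 is not of the form \<open>4 * t + 1\<close> and 5 needs \<open>t = 1\<close>.\<close>
  have "CARD('a) \<noteq> 3" "CARD('a) \<noteq> 5" using q(2) t1 by auto
  then have "\<not> CARD('a) dvd 3" "\<not> CARD('a) dvd 5"
    using q(1) primes_dvd_imp_eq[of "CARD('a)" 3] primes_dvd_imp_eq[of "CARD('a)" 5] by auto
  then have "\<not> CARD('a) dvd 3 * 5"
    using prime_dvd_multD[OF q(1)] by blast
  then have "(15::'a) \<noteq> 0"
    using of_nat_prime_card_eq_0_iff[OF q(1), of "3 * 5"] by simp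
  moreover have "(16::'a) = 1 + 15" by simp
  ultimately have "(16::'a) \<noteq> 1"
    by (metis add_cancel_right_right)
  then have "(16 ^ 2 :: 'a) \<noteq> 1"
    using w power_eq_1_coprime[of "16::'a" 2 t] t(2) by (auto simp del: power_numeral)
  moreover have "(16 ^ 2 :: 'a) ^ t = 1"
    using w by (metis power_commuting_commutes power_mult mult.commute power_one)
  ultimately have w2: "(16 ^ 2 :: 'a) ^ t = 1" "(16 ^ 2 :: 'a) \<noteq> 1"
    by blast+
  have "(monom 1 (2 ^ (n - 2)) + [:s * 16 ^ j:]) * (monom 1 (2 ^ (n - 2)) - [:s * 16 ^ j:])
      = monom 1 (2 ^ (n - 1)) + [:(16 ^ 2) ^ j:]" for j
  proof -
    have "(2::nat) ^ (n - 1) = 2 ^ (n - 2) + 2 ^ (n - 2)"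
      using n by (cases n) (auto simp: Suc_diff_Suc numeral_2_eq_2 simp flip: power_Suc mult_2)
    moreover have "(s * 16 ^ j) * (s * 16 ^ j) = s ^ 2 * (16 ^ 2) ^ j"
      by (simp only: power2_eq_square power_mult_distrib mult_ac)
    ultimately show ?thesis
      unfolding square_diff_square_factored[symmetric]
      by (simp add: mult_monom s const_poly_minus del: power_numeral minus_pCons)
  qed
  then show ?thesis
    using cyclotomic_two_power_times_prime_eq_prod[OF t w2, of "n - 1"] n by simp
qed

text \<open>The element \<open>w = 4 ^ (4 * N)\<close> is chosen so that each \<open>w ^ j\<close> is the \<open>4 * N\<close>-th power of
  \<open>4 ^ j\<close>; it differs from 1 because \<open>4 * N\<close> is a power of 2 and the order \<open>t\<close> of 4 is odd.\<close>

lemma cyclotomic_factorization_2t: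
  fixes h :: "'a::finite_field \<Rightarrow> 'b::finite_field" and \<beta> :: 'b
  assumes q: "prime CARD('a)" "CARD('a) = 2 * t + 1" and Q: "CARD('b) = CARD('a) ^ 2"
    and t: "prime t" "odd t"
    and h: "field_embedding h" and u: "CARD('a) ^ 2 = 2 ^ u * v + 1"
    and k: "3 \<le> k" "k \<le> u" and \<beta>: "primitive_root_of_unity (2 ^ k) \<beta>" and n: "n \<ge> k"
  shows "cyclotomic (2 ^ n * t) =
           (\<Prod>i\<in>{1..2 ^ (k - 3)}. \<Prod>j\<in>{1..t-1}.
              (monom 1 (2 ^ (n - k + 1))
                 + monom (4 ^ j * quad_trace h (\<beta> ^ (2 * i - 1))) (2 ^ (n - k))
                 + [:quad_chi h \<beta> * 16 ^ j:]) *
              (monom 1 (2 ^ (n - k + 1))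
                 - monom (4 ^ j * quad_trace h (\<beta> ^ (2 * i - 1))) (2 ^ (n - k))
                 + [:quad_chi h \<beta> * 16 ^ j:]))"
proof -
  define N :: nat where "N = 2 ^ (k - 3)"
  define M :: nat where "M = 2 ^ (n - k)"
  have k3: "k = Suc (Suc (Suc (k - 3)))" using k by simp
  have N8: "8 * N = 2 ^ k" and N4: "4 * N = 2 ^ (k - 1)"
    unfolding N_def by (subst (2) k3, simp)+
  have t1: "t > 1" using t(1) by (rule prime_gt_1_nat)
  have two: "(2::'a) \<noteq> 0"
    using of_nat_prime_card_eq_0_iff[OF q(1), of 2] q(2) t1 by (auto dest: dvd_imp_le)
  then have "(2::'a) ^ (2 * t) = 1"
    using power_card_minus_1[of "2::'a"] q(2) by simp
  then have w4: "(4::'a) ^ t = 1" by (simp add: power_mult)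
  have "(3::'a) \<noteq> 0"
    using of_nat_prime_card_eq_0_iff[OF q(1), of 3] q(2) t1 by (auto dest: dvd_imp_le)
  moreover have "(4::'a) = 1 + 3" by simp
  ultimately have "(4::'a) \<noteq> 1"
    by (metis add_cancel_right_right)
  moreover have "coprime (4 * N) t" "4 * N \<noteq> 0"
    unfolding N4 using t(2) by simp_all
  ultimately have "(4 ^ (4 * N) :: 'a) \<noteq> 1"
    using w4 power_eq_1_coprime[of "4::'a" "4 * N" t] by blast
  moreover have "(4 ^ (4 * N) :: 'a) ^ t = 1"
    using w4 by (metis power_mult mult.commute power_one)
  ultimately have w: "(4 ^ (4 * N) :: 'a) ^ t = 1" "(4 ^ (4 * N) :: 'a) \<noteq> 1"
    by blast+
  have "(4::'a) \<noteq> 0" using two by (metis mult_eq_0_iff mult_2 numeral_Bit0)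
  then have c0: "(4 ^ j :: 'a) \<noteq> 0" for j by simp
  \<comment> \<open>From \<open>2 ^ u * v = (q - 1) * (q + 1)\<close>: as \<open>q - 1 = 2 * t\<close> with \<open>t\<close> odd, the factor \<open>q + 1\<close> absorbs all but one of the twos.\<close>
  have "2 ^ u * v = 2 * (t * (CARD('a) + 1))"
    using u unfolding q(2) by (simp add: power2_eq_square algebra_simps)
  moreover have "(2::nat) ^ u = 2 * 2 ^ (u - 1)"
    using k by (simp flip: power_Suc)
  ultimately have "2 ^ (u - 1) dvd t * (CARD('a) + 1)"
    by (metis dvd_triv_left mult.assoc mult_left_cancel zero_neq_numeral)
  then have "2 ^ (u - 1) dvd CARD('a) + 1"
    using t(2) by (subst (asm) coprime_dvd_mult_right_iff) simp_all
  moreover have "(2::nat) ^ (k - 1) dvd 2 ^ (u - 1)"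
    using k by (intro le_imp_power_dvd) simp
  ultimately have dvd: "4 * N dvd CARD('a) + 1"
    unfolding N4 by (rule dvd_trans[rotated])
  have MN: "2 ^ (n - k + 1) = 2 * M" "4 * N * M = 2 ^ (n - 1)"
    unfolding N4 M_def using k n by (simp_all flip: power_add)
  have sq: "(16 ^ j :: 'a) = (4 ^ j) ^ 2" for j
    by (simp add: power2_eq_square flip: power_mult_distrib)
  have "cyclotomic (2 ^ n * t) = (\<Prod>j\<in>{1..t-1}. monom 1 (4 * N * M) + [:(4 ^ j) ^ (4 * N) :: 'a:])"
  proof -
    have "Suc (n - 1) = n" using n k by simp
    moreover have "((4::'a) ^ j) ^ (4 * N) = (4 ^ (4 * N)) ^ j" for j
      by (metis power_mult mult.commute)
    ultimately show ?thesis
      using cyclotomic_two_power_times_prime_eq_prod[OF t w, of "n - 1"] by (simp only: MN)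
  qed
  also have "\<dots> = (\<Prod>j\<in>{1..t-1}. \<Prod>i\<in>{1..N}.
      (monom 1 (2 * M) + monom (4 ^ j * quad_trace h (\<beta> ^ (2 * i - 1))) M + [:quad_chi h \<beta> * 16 ^ j:]) *
      (monom 1 (2 * M) - monom (4 ^ j * quad_trace h (\<beta> ^ (2 * i - 1))) M + [:quad_chi h \<beta> * 16 ^ j:]))"
    unfolding sq by (intro prod.cong refl,
      rule prod_quad_trace_factors[OF h q(1) Q \<beta>[folded N8] dvd c0, symmetric])
  finally show ?thesis
    unfolding MN by (subst prod.swap) (simp only: N_def M_def)
qed

theorem theorem4p5:
  fixes q t :: nat
  assumes "prime q" and "odd q" and "prime t" and "odd t"
    and "CARD('a::finite_field) = q"
  shows
    "(q = 4 * t + 1 \<longrightarrow>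
      (\<forall>(s::'a) (n::nat). s ^ 2 = -1 \<longrightarrow> n \<ge> 2 \<longrightarrow>
         cyclotomic (2 ^ n * t) =
           (\<Prod>j\<in>{1..t-1}.
              (monom 1 (2 ^ (n - 2)) + [:s * 16 ^ j:]) *
              (monom 1 (2 ^ (n - 2)) - [:s * 16 ^ j:])))) \<and>
     (q = 2 * t + 1 \<and> CARD('b::finite_field) = q ^ 2 \<longrightarrow>
      (\<forall>(h::'a \<Rightarrow> 'b) (u::nat) (v::nat) (k::nat) (\<beta>::'b) (n::nat).
         field_embedding h \<longrightarrow> q ^ 2 = 2 ^ u * v + 1 \<longrightarrow> odd v \<longrightarrow>
         3 \<le> k \<longrightarrow> k \<le> u \<longrightarrow> primitive_root_of_unity (2 ^ k) \<beta> \<longrightarrow> n \<ge> k \<longrightarrow>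
         cyclotomic (2 ^ n * t) =
           (\<Prod>i\<in>{1..2 ^ (k - 3)}. \<Prod>j\<in>{1..t-1}.
              (monom 1 (2 ^ (n - k + 1))
                 + monom (4 ^ j * quad_trace h (\<beta> ^ (2 * i - 1))) (2 ^ (n - k))
                 + [:quad_chi h \<beta> * 16 ^ j:]) *
              (monom 1 (2 ^ (n - k + 1))
                 - monom (4 ^ j * quad_trace h (\<beta> ^ (2 * i - 1))) (2 ^ (n - k))
                 + [:quad_chi h \<beta> * 16 ^ j:]))))"
proof (intro conjI impI allI, goal_cases)
  case 1
  show ?case
    by (rule cyclotomic_factorization_4t) (use 1 assms in auto)
next
  case prems: (2 h u v k \<beta> n)
  have u: "CARD('a) ^ 2 = 2 ^ u * v + 1"
    using prems assms(5) by simp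
  show ?case
    by (rule cyclotomic_factorization_2t[OF _ _ _ _ _ _ u]) (use prems assms in auto)
qed

end
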